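(* Let $V\in\mathbb{R}^{n\times n}$ be a covariance matrix (symmetric positive semidefinite), let $\eta=\operatorname{diag}(V)$, and let $D=\tfrac12(\eta\mathbf 1_n^\top+\mathbf 1_n\eta^\top)-V$. Let $D^-$ be a generalized inverse of $D$ (i.e. $DD^-D=D$ and $D^-DD^-=D^-$), and assume $\mathbf 1_n^\top D^-\mathbf 1_n\neq 0$, so that $\mathbf w_{\mathrm{mdrp}}=D^-\mathbf 1_n/(\mathbf 1_n^\top D^-\mathbf 1_n)$ is well defined. Let $A\in\mathbb{R}^{n\times n}$ be symmetric positive definite, $\|\mathbf w\|_A:=\sqrt{\mathbf w^\top A\mathbf w}$, and let $\beta>0$ be defined by $\beta^2:=\lambda_{\min}(A)/\lambda_{\max}(B)$. Let $\tau>0$. Then every $\mathbf w\in\mathbb{R}^n$ with $\mathbf 1_n^\top\mathbf w=1$ and $\|\mathbf w\|_A\le\tau$ satisfies $$c(\mathbf w)\le\frac{\tau}{\beta},\qquad\text{or equivalently}\qquad q(\mathbf w)\ge q_{\max}-\Big(\frac{\tau}{\beta}\Big)^2 .$$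
   Context: $\mathbf 1_n\in\mathbb{R}^n$ is the all-ones column vector and $\operatorname{diag}(V)$ is the column vector of diagonal entries of $V$. The diversification return of $\mathbf w$ with $\mathbf 1_n^\top\mathbf w=1$ is $q(\mathbf w)=\tfrac12(\eta^\top\mathbf w-\mathbf w^\top V\mathbf w)$, and $q_{\max}=q(\mathbf w_{\mathrm{mdrp}})$. Put $\mathbf s=\mathbf w_{\mathrm{mdrp}}$, $J_{\mathbf s}=I_n-\mathbf s\mathbf 1_n^\top$ and $B=-\tfrac12 J_{\mathbf s}^\top DJ_{\mathbf s}$, which is positive semidefinite and nonzero. The centrality of $\mathbf w$ is $c(\mathbf w)=\sqrt{\mathbf w^\top B\mathbf w}$. $\lambda_{\min}(\cdot)$ and $\lambda_{\max}(\cdot)$ denote the smallest and largest eigenvalues of a symmetric matrix. *)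

theory Defs
  imports "HOL-Analysis.Analysis"
begin

text \<open>
  Vectors are columns in \<open>real ^ 'n\<close> and \<open>n\<close> is \<open>CARD('n)\<close>. The all-ones vector is the library
  constant \<open>1 :: real ^ 'n\<close>, whereas the identity matrix is \<open>mat 1\<close>. The matrix \<open>x y\<^sup>T\<close> is \<open>outer x y\<close>.
\<close>

definition outer :: "real ^ 'n \<Rightarrow> real ^ 'n \<Rightarrow> real ^ 'n ^ 'n" where
  "outer x y = (\<chi> i j. x $ i * y $ j)"

definition sym_mat :: "real ^ 'n ^ 'n \<Rightarrow> bool" where
  "sym_mat M \<longleftrightarrow> transpose M = M"

definition psd :: "real ^ 'n ^ 'n \<Rightarrow> bool" where
  "psd M \<longleftrightarrow> sym_mat M \<and> (\<forall>x. 0 \<le> x \<bullet> (M *v x))"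

definition pos_def :: "real ^ 'n ^ 'n \<Rightarrow> bool" where
  "pos_def M \<longleftrightarrow> sym_mat M \<and> (\<forall>x. x \<noteq> 0 \<longrightarrow> 0 < x \<bullet> (M *v x))"

definition eigenvalues :: "real ^ 'n ^ 'n \<Rightarrow> real set" where
  "eigenvalues M = {k. \<exists>x. x \<noteq> 0 \<and> M *v x = k *\<^sub>R x}"

text \<open>
  The next two are meaningful for symmetric matrices only, where the set of (real) eigenvalues is
  finite and nonempty.
\<close>

definition lambda_min :: "real ^ 'n ^ 'n \<Rightarrow> real" where
  "lambda_min M = Min (eigenvalues M)"

definition lambda_max :: "real ^ 'n ^ 'n \<Rightarrow> real" where
  "lambda_max M = Max (eigenvalues M)"

definition diag_vec :: "real ^ 'n ^ 'n \<Rightarrow> real ^ 'n" where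
  "diag_vec M = (\<chi> i. M $ i $ i)"

definition generalized_inverse :: "real ^ 'n ^ 'n \<Rightarrow> real ^ 'n ^ 'n \<Rightarrow> bool" where
  "generalized_inverse M G \<longleftrightarrow> M ** G ** M = M \<and> G ** M ** G = G"

definition distance_matrix :: "real ^ 'n ^ 'n \<Rightarrow> real ^ 'n ^ 'n" where
  "distance_matrix V =
     (1/2) *\<^sub>R (outer (diag_vec V) 1 + outer 1 (diag_vec V)) - V"

definition mdrp :: "real ^ 'n ^ 'n \<Rightarrow> real ^ 'n" where
  "mdrp G = (1 / (1 \<bullet> (G *v 1))) *\<^sub>R (G *v 1)"

definition diversification_return :: "real ^ 'n ^ 'n \<Rightarrow> real ^ 'n \<Rightarrow> real" where
  "diversification_return V w = (1/2) * (diag_vec V \<bullet> w - w \<bullet> (V *v w))"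

definition centering :: "real ^ 'n \<Rightarrow> real ^ 'n ^ 'n" where
  "centering s = mat 1 - outer s 1"

definition centrality_matrix :: "real ^ 'n ^ 'n \<Rightarrow> real ^ 'n \<Rightarrow> real ^ 'n ^ 'n" where
  "centrality_matrix D s = (- 1/2) *\<^sub>R (transpose (centering s) ** D ** centering s)"

text \<open>
  \<open>quad_norm A\<close> is a norm if \<open>A\<close> is positive definite, and a seminorm if it is only positive
  semidefinite; the centrality of \<open>w\<close> is \<open>quad_norm B w\<close> for the centrality matrix \<open>B\<close>.
\<close>

definition quad_norm :: "real ^ 'n ^ 'n \<Rightarrow> real ^ 'n \<Rightarrow> real" where
  "quad_norm A w = sqrt (w \<bullet> (A *v w))"

definition centrality :: "real ^ 'n ^ 'n \<Rightarrow> real ^ 'n \<Rightarrow> real ^ 'n \<Rightarrow> real" where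
  "centrality D s w = quad_norm (centrality_matrix D s) w"

end

theory Submission
  imports Defs
begin

text \<open>
  On the hyperplane \<open>1 \<bullet> w = 1\<close> the diversification return is \<open>w \<bullet> (D *v w) / 2\<close>, and \<open>D\<close> is
  negative semidefinite on the orthogonal complement of \<open>1\<close>. If \<open>D *v x = 0\<close> for some \<open>x\<close> with
  \<open>1 \<bullet> x = 1\<close>, then \<open>x\<close> is a maximiser with value \<open>0\<close>; since the entries of \<open>D\<close> are nonnegative, this forces
  \<open>D = 0\<close>, hence \<open>G = G ** D ** G = 0\<close>, which is excluded. So \<open>1\<close> is orthogonal to the kernel of the symmetric
  matrix \<open>D\<close>, i.e. lies in its range, and \<open>D ** G\<close> fixes it: \<open>D *v s\<close> is a multiple of \<open>1\<close>. Expanding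
  the quadratic form around \<open>s\<close> then shows that the squared centrality of \<open>w\<close> is
  \<open>q_max - diversification_return V w\<close>, and comparing Rayleigh quotients of \<open>A\<close> and \<open>B\<close> gives the bound.
\<close>

subsection \<open>Rayleigh quotients of symmetric matrices\<close>

lemma inner_transpose_matrix_vector:
  fixes M :: "real ^ 'n ^ 'n"
  shows "x \<bullet> (transpose M *v y) = (M *v x) \<bullet> y"
  by (metis dot_lmul_matrix inner_commute transpose_matrix_vector)

lemma sym_mat_inner:
  assumes "sym_mat M"
  shows "x \<bullet> (M *v y) = (M *v x) \<bullet> y"
  using assms inner_transpose_matrix_vector[of x M y] by (simp add: sym_mat_def)

lemma sym_mat_uminus: "sym_mat M \<Longrightarrow> sym_mat (- M)"
  by (simp add: sym_mat_def transpose_def vec_eq_iff)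

lemma matrix_vector_mult_uminus:
  fixes M :: "real ^ 'n ^ 'n"
  shows "(- M) *v x = - (M *v x)"
  by (simp add: matrix_vector_mult_def vec_eq_iff sum_negf)

lemma scaleR_matrix_vector_mult:
  fixes M :: "real ^ 'n ^ 'n"
  shows "(c *\<^sub>R M) *v x = c *\<^sub>R (M *v x)"
  by (simp add: scaleR_matrix_vector_assoc)

text \<open>If \<open>y = N *v x\<close> were nonzero, moving from \<open>x\<close> slightly in the
  direction \<open>- y\<close> would make the form negative, because the linear term
  \<open>2 * t * a\<close> dominates the quadratic one.\<close>

lemma psd_inner_zero_imp_kernel:
  assumes "psd N" and "x \<bullet> (N *v x) = 0"
  shows "N *v x = 0"
proof (rule ccontr)
  define y where "y = N *v x"
  define a where "a = y \<bullet> y"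
  define c where "c = y \<bullet> (N *v y)"
  assume "N *v x \<noteq> 0"
  then have a: "a > 0" by (simp add: a_def y_def)
  have c: "c \<ge> 0" using assms by (simp add: c_def psd_def)
  have sym: "x \<bullet> (N *v y) = a"
    using assms sym_mat_inner[of N x y] by (simp add: psd_def y_def a_def)
  have expand: "(x + t *\<^sub>R y) \<bullet> (N *v (x + t *\<^sub>R y)) = 2 * t * a + t\<^sup>2 * c" for t
    using assms sym
    by (simp add: matrix_vector_right_distrib matrix_vector_mult_scaleR inner_add
        y_def[symmetric] a_def c_def power2_eq_square algebra_simps)
  have "0 \<le> 2 * t * a + t\<^sup>2 * c" for t
    using assms(1) by (metis expand psd_def)
  \<comment> \<open>The shift \<open>c + 1\<close> keeps the denominator positive even for
    \<open>c = 0\<close>, and it still gives \<open>t * c > - a\<close>.\<close>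
  moreover define t where "t = - a / (c + 1)"
  ultimately have "0 \<le> t * (2 * a + t * c)"
    by (metis (no_types) distrib_left mult.assoc mult.commute power2_eq_square)
  moreover have "t < 0" using a c by (simp add: t_def)
  moreover have "2 * a + t * c > 0"
  proof -
    have "a * c < 2 * a * (c + 1)" using a c by (simp add: algebra_simps add_nonneg_pos)
    then have "a * c / (c + 1) < 2 * a" using c by (simp add: pos_divide_less_eq)
    then show ?thesis by (simp add: t_def)
  qed
  ultimately show False by (meson mult_neg_pos not_le)
qed

text \<open>Eigenvectors for distinct eigenvalues are orthogonal, hence independent, so choosing one
  per eigenvalue yields a finite family. Finiteness is what makes \<open>Min\<close> and
  \<open>Max\<close> of the spectrum usable.\<close>

lemma finite_eigenvalues_sym_mat:
  fixes M :: "real ^ 'n ^ 'n"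
  assumes "sym_mat M"
  shows "finite (eigenvalues M)"
proof -
  define f where "f k = (SOME x. x \<noteq> 0 \<and> M *v x = k *\<^sub>R x)" for k
  have f: "f k \<noteq> 0" "M *v f k = k *\<^sub>R f k" if "k \<in> eigenvalues M" for k
    using that someI_ex[of "\<lambda>x. x \<noteq> 0 \<and> M *v x = k *\<^sub>R x"]
    unfolding f_def eigenvalues_def by auto
  have orth: "f k \<bullet> f l = 0" if "k \<in> eigenvalues M" "l \<in> eigenvalues M" "k \<noteq> l" for k l
  proof -
    have "l * (f k \<bullet> f l) = k * (f k \<bullet> f l)"
      using sym_mat_inner[OF assms, of "f k" "f l"] f that by simp
    then show ?thesis using that by simp
  qed
  have inj: "inj_on f (eigenvalues M)"
    by (rule inj_onI) (metis f(1) inner_eq_zero_iff orth)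
  have "pairwise orthogonal (f ` eigenvalues M)"
    using orth by (auto simp: pairwise_def orthogonal_def)
  moreover have "0 \<notin> f ` eigenvalues M" using f by force
  ultimately have "finite (f ` eigenvalues M)"
    using pairwise_orthogonal_independent independent_imp_finite by blast
  then show ?thesis using inj finite_imageD by blast
qed

text \<open>Compactness of the unit sphere gives a maximiser \<open>u\<close>. With \<open>m\<close>
  the maximum, \<open>m *\<^sub>R mat 1 - M\<close> is positive semidefinite and its form vanishes
  at \<open>u\<close>, so \<open>u\<close> lies in its kernel.\<close>

lemma rayleigh_max_is_eigenvalue:
  fixes M :: "real ^ 'n ^ 'n"
  assumes "sym_mat M"
  shows "\<exists>m \<in> eigenvalues M. \<forall>x. x \<bullet> (M *v x) \<le> m * (x \<bullet> x)"
proof -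
  have cont: "continuous_on (sphere 0 1) (\<lambda>x. x \<bullet> (M *v x))"
    by (intro continuous_intros matrix_vector_mult_linear_continuous_on)
  have "\<exists>u \<in> sphere 0 1. \<forall>x \<in> sphere 0 1. x \<bullet> (M *v x) \<le> u \<bullet> (M *v u)"
    by (rule continuous_attains_sup[OF compact_sphere _ cont]) simp
  then obtain u where u: "u \<in> sphere 0 1"
    and max: "\<And>x. x \<in> sphere 0 1 \<Longrightarrow> x \<bullet> (M *v x) \<le> u \<bullet> (M *v u)"
    by blast
  define m where "m = u \<bullet> (M *v u)"
  have le: "x \<bullet> (M *v x) \<le> m * (x \<bullet> x)" for x
  proof (cases "x = 0")
    case False
    then have "(x /\<^sub>R norm x) \<bullet> (M *v (x /\<^sub>R norm x)) \<le> m"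
      unfolding m_def by (intro max) simp
    moreover have "(x /\<^sub>R norm x) \<bullet> (M *v (x /\<^sub>R norm x)) = x \<bullet> (M *v x) / (x \<bullet> x)"
      by (simp add: matrix_vector_mult_scaleR dot_square_norm power2_eq_square divide_simps)
    ultimately show ?thesis
      using False by (simp add: divide_le_eq)
  qed simp
  define N where "N = m *\<^sub>R mat 1 - M"
  have N: "N *v x = m *\<^sub>R x - M *v x" for x
    by (simp add: N_def matrix_vector_mult_diff_rdistrib scaleR_matrix_vector_mult)
  have "sym_mat N"
    using assms by (simp add: sym_mat_def N_def transpose_def vec_eq_iff mat_def)
  then have "psd N"
    using le by (simp add: psd_def N inner_diff_right)
  moreover have "u \<bullet> u = 1" using u by (simp add: dot_square_norm)
  ultimately have "N *v u = 0"
    by (intro psd_inner_zero_imp_kernel) (simp_all add: N inner_diff_right m_def)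
  then have "m \<in> eigenvalues M"
    using u by (auto simp: eigenvalues_def N intro!: exI[of _ u])
  with le show ?thesis by blast
qed

lemma rayleigh_le_lambda_max:
  fixes M :: "real ^ 'n ^ 'n"
  assumes "sym_mat M"
  shows "x \<bullet> (M *v x) \<le> lambda_max M * (x \<bullet> x)"
proof -
  obtain m where m: "m \<in> eigenvalues M" "x \<bullet> (M *v x) \<le> m * (x \<bullet> x)"
    using rayleigh_max_is_eigenvalue[OF assms] by blast
  moreover have "m \<le> lambda_max M"
    using m finite_eigenvalues_sym_mat[OF assms] by (simp add: lambda_max_def)
  ultimately show ?thesis
    by (meson inner_ge_zero mult_right_mono order_trans)
qed

lemma eigenvalues_uminus:
  fixes M :: "real ^ 'n ^ 'n"
  shows "k \<in> eigenvalues (- M) \<longleftrightarrow> - k \<in> eigenvalues M"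
  unfolding eigenvalues_def mem_Collect_eq matrix_vector_mult_uminus scaleR_minus_left
  by (metis minus_minus)

lemma rayleigh_ge_lambda_min:
  fixes M :: "real ^ 'n ^ 'n"
  assumes "sym_mat M"
  shows "lambda_min M * (x \<bullet> x) \<le> x \<bullet> (M *v x)"
proof -
  obtain m where m: "m \<in> eigenvalues (- M)" "x \<bullet> ((- M) *v x) \<le> m * (x \<bullet> x)"
    using rayleigh_max_is_eigenvalue[OF sym_mat_uminus[OF assms]] by blast
  then have "lambda_min M \<le> - m"
    using finite_eigenvalues_sym_mat[OF assms] by (simp add: lambda_min_def eigenvalues_uminus)
  then have "lambda_min M * (x \<bullet> x) \<le> - m * (x \<bullet> x)"
    by (intro mult_right_mono) auto
  with m show ?thesis by (simp add: matrix_vector_mult_uminus)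
qed

text \<open>The spectrum is finite and nonempty, so the minimum is a genuine eigenvalue, and the
  form can be evaluated at an eigenvector for it.\<close>

lemma lambda_min_pos:
  fixes M :: "real ^ 'n ^ 'n"
  assumes "pos_def M"
  shows "lambda_min M > 0"
proof -
  have sym: "sym_mat M" using assms by (simp add: pos_def_def)
  have "eigenvalues M \<noteq> {}" using rayleigh_max_is_eigenvalue[OF sym] by blast
  then have "lambda_min M \<in> eigenvalues M"
    using finite_eigenvalues_sym_mat[OF sym] by (simp add: lambda_min_def)
  then obtain x where x: "x \<noteq> 0" "M *v x = lambda_min M *\<^sub>R x" by (auto simp: eigenvalues_def)
  then have "0 < lambda_min M * (x \<bullet> x)" using assms by (metis inner_scaleR_right pos_def_def)
  then show ?thesis using x by (metis inner_gt_zero_iff zero_less_mult_pos2)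
qed

subsection \<open>The distance matrix\<close>

lemma outer_matrix_vector: "outer x y *v z = (y \<bullet> z) *\<^sub>R x"
  by (simp add: outer_def matrix_vector_mult_def inner_vec_def vec_eq_iff sum_distrib_left
      mult_ac)

lemma distance_matrix_form:
  "x \<bullet> (distance_matrix V *v y) =
     ((1 \<bullet> y) * (diag_vec V \<bullet> x) + (1 \<bullet> x) * (diag_vec V \<bullet> y)) / 2 - x \<bullet> (V *v y)"
  by (simp add: distance_matrix_def matrix_vector_mult_diff_rdistrib scaleR_matrix_vector_mult
      matrix_vector_mult_add_rdistrib outer_matrix_vector inner_diff_right inner_add_right
      inner_commute algebra_simps)

lemma sym_mat_distance_matrix: "psd V \<Longrightarrow> sym_mat (distance_matrix V)"
  by (simp add: psd_def sym_mat_def distance_matrix_def outer_def transpose_def vec_eq_iff)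

lemma distance_matrix_nonpos:
  assumes "psd V" and "1 \<bullet> x = 0"
  shows "x \<bullet> (distance_matrix V *v x) \<le> 0"
  using assms by (simp add: distance_matrix_form psd_def)

lemma diversification_return_eq:
  assumes "1 \<bullet> w = 1"
  shows "diversification_return V w = (w \<bullet> (distance_matrix V *v w)) / 2"
  using assms by (simp add: distance_matrix_form diversification_return_def)

lemma inner_one_axis: "(1 :: real ^ 'n) \<bullet> axis i 1 = 1"
  by (simp add: inner_axis)

lemma axis_matrix_axis:
  fixes M :: "real ^ 'n ^ 'n"
  shows "axis i 1 \<bullet> (M *v axis j 1) = M $ i $ j"
  by (simp add: inner_axis' matrix_vector_mul_component inner_axis)

lemma distance_matrix_diag: "distance_matrix V $ i $ i = 0"
  by (simp add: distance_matrix_def outer_def diag_vec_def)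

text \<open>Vectors supported on two coordinates isolate a single entry because the diagonal of the
  distance matrix vanishes. Signs of the form on such vectors thereby become signs of
  entries.\<close>

lemma distance_matrix_form_axis:
  assumes "psd V"
  shows "(a *\<^sub>R axis i 1 + b *\<^sub>R axis j 1) \<bullet>
      (distance_matrix V *v (a *\<^sub>R axis i 1 + b *\<^sub>R axis j 1)) = 2 * a * b * distance_matrix V $ i $ j"
proof -
  have "distance_matrix V $ j $ i = distance_matrix V $ i $ j"
    using sym_mat_distance_matrix[OF assms]
    by (simp add: sym_mat_def transpose_def vec_eq_iff)
  then show ?thesis
    by (simp add: matrix_vector_right_distrib matrix_vector_mult_scaleR inner_add
        axis_matrix_axis distance_matrix_diag)
qed

lemma distance_matrix_entry_nonneg:
  assumes "psd V"
  shows "0 \<le> distance_matrix V $ i $ j"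
  using distance_matrix_nonpos[OF assms, of "1 *\<^sub>R axis i 1 + (- 1) *\<^sub>R axis j 1"]
  unfolding distance_matrix_form_axis[OF assms]
  by (simp add: inner_diff_right inner_one_axis)

lemma distance_matrix_kernel_orthogonal_one:
  fixes V :: "real ^ 'n ^ 'n"
  assumes "psd V" and "distance_matrix V \<noteq> 0" and "distance_matrix V *v x = 0"
  shows "1 \<bullet> x = 0"
proof (rule ccontr)
  let ?D = "distance_matrix V"
  assume "1 \<bullet> x \<noteq> 0"
  define y where "y = x /\<^sub>R (1 \<bullet> x)"
  have y: "1 \<bullet> y = 1" "?D *v y = 0"
    using assms \<open>1 \<bullet> x \<noteq> 0\<close> by (simp_all add: y_def matrix_vector_mult_scaleR)
  \<comment> \<open>Subtracting the kernel vector \<open>y\<close> leaves the form unchanged and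
    moves \<open>w\<close> into the complement of \<open>1\<close>.\<close>
  have le: "w \<bullet> (?D *v w) \<le> 0" if "1 \<bullet> w = 1" for w
  proof -
    have "(w - y) \<bullet> (?D *v (w - y)) \<le> 0"
      using that y by (intro distance_matrix_nonpos assms) (simp add: inner_diff_right)
    moreover have "y \<bullet> (?D *v w) = 0"
      using sym_mat_inner[OF sym_mat_distance_matrix[OF assms(1)], of y w] y by simp
    ultimately show ?thesis
      using y by (simp add: matrix_vector_mult_diff_distrib inner_diff_left)
  qed
  \<comment> \<open>The midpoint of two axis vectors lies on the hyperplane, and the form there is
    half the entry.\<close>
  have "?D $ i $ j \<le> 0" for i j
    using le[of "(1/2) *\<^sub>R axis i 1 + (1/2) *\<^sub>R axis j 1"]
    unfolding distance_matrix_form_axis[OF assms(1)]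
    by (simp add: inner_add_right inner_one_axis)
  then have "?D = 0"
    using distance_matrix_entry_nonneg[OF assms(1)] by (simp add: vec_eq_iff order_antisym)
  with assms show False by simp
qed

lemma generalized_inverse_fixes_one:
  fixes V G :: "real ^ 'n ^ 'n"
  assumes "psd V" and "distance_matrix V \<noteq> 0" and "generalized_inverse (distance_matrix V) G"
  shows "distance_matrix V *v (G *v 1) = 1"
proof -
  let ?D = "distance_matrix V"
  define r where "r = 1 - ?D *v (G *v 1)"
  have D: "transpose ?D = ?D"
    using sym_mat_distance_matrix[OF assms(1)] by (simp add: sym_mat_def)
  have "transpose (?D ** G ** ?D) = ?D"
    using assms(3) D by (simp add: generalized_inverse_def)
  \<comment> \<open>\<open>G\<close> need not be symmetric, so the defining identity is transposed.
    It puts \<open>r - transpose (?D ** G) *v r\<close> in the kernel, and orthogonality to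
    \<open>1\<close> then says that the residual \<open>r\<close> is orthogonal to itself.\<close>
  then have "?D ** transpose (?D ** G) = ?D"
    by (simp add: matrix_transpose_mul[of "?D ** G"] D)
  then have "?D *v (r - transpose (?D ** G) *v r) = 0"
    by (simp add: matrix_vector_mult_diff_distrib matrix_vector_mul_assoc
        del: transpose_matrix_vector)
  then have "1 \<bullet> (r - transpose (?D ** G) *v r) = 0"
    by (rule distance_matrix_kernel_orthogonal_one[OF assms(1,2)])
  then have "1 \<bullet> r = (?D *v (G *v 1)) \<bullet> r"
    by (simp add: inner_diff_right inner_transpose_matrix_vector matrix_vector_mul_assoc
        del: transpose_matrix_vector)
  then have "r \<bullet> r = 0"
    by (subst (1) r_def) (simp add: inner_diff_left)
  then show ?thesis by (simp add: r_def)
qed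

subsection \<open>The centrality matrix\<close>

lemma centering_matrix_vector: "centering s *v w = w - (1 \<bullet> w) *\<^sub>R s"
  by (simp add: centering_def matrix_vector_mult_diff_rdistrib outer_matrix_vector)

lemma centrality_matrix_form:
  "w \<bullet> (centrality_matrix D s *v w) =
     - ((w - (1 \<bullet> w) *\<^sub>R s) \<bullet> (D *v (w - (1 \<bullet> w) *\<^sub>R s))) / 2"
proof -
  have "centrality_matrix D s *v w =
      (- 1/2) *\<^sub>R (transpose (centering s) *v (D *v (centering s *v w)))"
    unfolding centrality_matrix_def scaleR_matrix_vector_mult
    by (simp add: matrix_vector_mul_assoc matrix_mul_assoc)
  then show ?thesis
    by (simp add: inner_transpose_matrix_vector centering_matrix_vector
        del: transpose_matrix_vector)
qed

lemma sym_mat_centrality_matrix: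
  assumes "sym_mat D"
  shows "sym_mat (centrality_matrix D s)"
proof -
  have "transpose (transpose (centering s) ** D ** centering s)
      = transpose (centering s) ** D ** centering s"
    using assms by (simp add: matrix_transpose_mul sym_mat_def matrix_mul_assoc)
  then show ?thesis
    by (simp add: centrality_matrix_def sym_mat_def transpose_def vec_eq_iff)
qed

text \<open>A difference of two axis vectors is unchanged by centering, so a positive entry of the
  distance matrix gives a positive Rayleigh quotient. This keeps the denominator in
  \<open>\<beta>\<close> positive.\<close>

lemma lambda_max_centrality_matrix_pos:
  fixes V :: "real ^ 'n ^ 'n"
  assumes "psd V" and "distance_matrix V \<noteq> 0"
  shows "lambda_max (centrality_matrix (distance_matrix V) s) > 0"
proof -
  let ?D = "distance_matrix V"
  let ?B = "centrality_matrix ?D s"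
  obtain i j where "?D $ i $ j \<noteq> 0"
    using assms(2) by (auto simp: vec_eq_iff)
  then have pos: "?D $ i $ j > 0"
    using distance_matrix_entry_nonneg[OF assms(1), of i j] by simp
  define z :: "real ^ 'n" where "z = 1 *\<^sub>R axis i 1 + (- 1) *\<^sub>R axis j 1"
  have "1 \<bullet> z = 0" by (simp add: z_def inner_diff_right inner_one_axis)
  moreover have "z \<bullet> (?D *v z) = - 2 * ?D $ i $ j"
    unfolding z_def distance_matrix_form_axis[OF assms(1)] by simp
  ultimately have "z \<bullet> (?B *v z) > 0"
    using pos by (simp add: centrality_matrix_form)
  also have "z \<bullet> (?B *v z) \<le> lambda_max ?B * (z \<bullet> z)"
    by (intro rayleigh_le_lambda_max sym_mat_centrality_matrix sym_mat_distance_matrix assms)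
  finally show ?thesis by (metis inner_ge_zero mult_nonpos_nonneg not_le)
qed

text \<open>Since \<open>distance_matrix V *v s\<close> is a multiple of \<open>1\<close>, both
  cross terms and the term at \<open>s\<close> equal \<open>k\<close>. What remains is
  \<open>(k - w \<bullet> (distance_matrix V *v w)) / 2\<close>, the difference of the two
  returns.\<close>

lemma centrality_matrix_form_eq_return_gap:
  fixes V :: "real ^ 'n ^ 'n"
  assumes "psd V" and "1 \<bullet> s = 1" and "distance_matrix V *v s = k *\<^sub>R 1" and "1 \<bullet> w = 1"
  shows "w \<bullet> (centrality_matrix (distance_matrix V) s *v w)
    = diversification_return V s - diversification_return V w"
proof -
  have "w \<bullet> (distance_matrix V *v s) = k" "s \<bullet> (distance_matrix V *v s) = k"
    using assms by (simp_all add: inner_commute)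
  moreover have "s \<bullet> (distance_matrix V *v w) = k"
    using sym_mat_inner[OF sym_mat_distance_matrix[OF assms(1)], of s w] assms by simp
  ultimately show ?thesis
    using assms(2,4)
    by (simp add: centrality_matrix_form diversification_return_eq
        matrix_vector_mult_diff_distrib inner_diff_left inner_diff_right field_simps)
qed

theorem mainTheorem5:
  fixes V D G A B :: "real ^ 'n ^ 'n" and s :: "real ^ 'n" and \<beta> \<tau> q_max :: real
  assumes "psd V"
    and "D = distance_matrix V"
    and "generalized_inverse D G"
    and "1 \<bullet> (G *v 1) \<noteq> 0"
    and "s = mdrp G"
    and "q_max = diversification_return V s"
    and "B = centrality_matrix D s"
    and "pos_def A"
    and "\<beta> = sqrt (lambda_min A / lambda_max B)"
    and "\<tau> > 0"
  shows "\<beta> > 0 \<and>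
    (\<forall>w. 1 \<bullet> w = 1 \<and> quad_norm A w \<le> \<tau> \<longrightarrow>
       centrality D s w \<le> \<tau> / \<beta> \<and>
       diversification_return V w \<ge> q_max - (\<tau> / \<beta>)\<^sup>2) \<and>
    (\<forall>w. 1 \<bullet> w = 1 \<longrightarrow>
       (centrality D s w \<le> \<tau> / \<beta> \<longleftrightarrow>
        diversification_return V w \<ge> q_max - (\<tau> / \<beta>)\<^sup>2))"
proof -
  have D0: "distance_matrix V \<noteq> 0"
  proof
    assume "distance_matrix V = 0"
    then have "G = 0"
      using assms(2,3) by (simp add: generalized_inverse_def matrix_matrix_mult_def vec_eq_iff)
    with assms(4) show False by simp
  qed
  have DG: "D *v (G *v 1) = 1"
    using generalized_inverse_fixes_one[OF assms(1) D0] assms by simp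
  have s: "1 \<bullet> s = 1" "D *v s = (1 / (1 \<bullet> (G *v 1))) *\<^sub>R 1"
    using assms(4) DG by (simp_all add: assms(5) mdrp_def matrix_vector_mult_scaleR)
  have gap: "w \<bullet> (B *v w) = q_max - diversification_return V w" if "1 \<bullet> w = 1" for w
    using centrality_matrix_form_eq_return_gap[OF assms(1) s(1) _ that] s(2)
    by (simp add: assms(2,6,7))
  have lA: "lambda_min A > 0" using assms(8) by (rule lambda_min_pos)
  have lB: "lambda_max B > 0"
    using lambda_max_centrality_matrix_pos[OF assms(1) D0] assms by simp
  have beta: "\<beta> > 0" using lA lB assms(9) by simp
  have beta2: "(\<tau> / \<beta>)\<^sup>2 = lambda_max B * \<tau>\<^sup>2 / lambda_min A"
    using lA lB by (simp add: assms(9) power_divide)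
  have symA: "sym_mat A" and symB: "sym_mat B"
    using assms sym_mat_centrality_matrix sym_mat_distance_matrix by (auto simp: pos_def_def)
  have equiv: "centrality D s w \<le> \<tau> / \<beta> \<longleftrightarrow> diversification_return V w \<ge> q_max - (\<tau> / \<beta>)\<^sup>2"
    if "1 \<bullet> w = 1" for w
  proof -
    have "centrality D s w \<le> \<tau> / \<beta> \<longleftrightarrow> w \<bullet> (B *v w) \<le> (\<tau> / \<beta>)\<^sup>2"
      using beta assms(10) real_sqrt_le_iff[of "w \<bullet> (B *v w)" "(\<tau> / \<beta>)\<^sup>2"]
      by (simp add: centrality_def quad_norm_def assms(7))
    then show ?thesis using gap[OF that] by auto
  qed
  \<comment> \<open>The two forms are compared through the Euclidean square
    \<open>w \<bullet> w\<close>: \<open>A\<close> bounds it from above by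
    \<open>\<tau>\<^sup>2 / lambda_min A\<close>, and \<open>B\<close> costs at most a factor
    \<open>lambda_max B\<close>.\<close>
  have bound: "w \<bullet> (B *v w) \<le> (\<tau> / \<beta>)\<^sup>2" if "quad_norm A w \<le> \<tau>" for w
  proof -
    have "w \<bullet> (A *v w) \<le> \<tau>\<^sup>2"
      using that assms(10) by (simp add: quad_norm_def sqrt_le_D)
    with rayleigh_ge_lambda_min[OF symA, of w] have "w \<bullet> w \<le> \<tau>\<^sup>2 / lambda_min A"
      using lA by (simp add: pos_le_divide_eq mult.commute)
    then have "lambda_max B * (w \<bullet> w) \<le> (\<tau> / \<beta>)\<^sup>2"
      using lB mult_left_mono[of "w \<bullet> w" "\<tau>\<^sup>2 / lambda_min A" "lambda_max B"]
      by (simp add: beta2)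
    with rayleigh_le_lambda_max[OF symB, of w] show ?thesis by simp
  qed
  show ?thesis
    using beta equiv bound gap by (metis diff_le_eq add.commute)
qed

end
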